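(* Let $\alpha\in[0,\pi]$ be such that $z=\cos\alpha$ satisfies $0\le z<1$, and define $f_\alpha:[-1,1]\to\mathbb{R}$ by $$f_\alpha(t):=\begin{cases}\dfrac{z-t^2}{1-z}, & \text{if } t<-\sqrt{z},\\[2mm] 0, & \text{if } -\sqrt{z}\le t\le z,\\[1mm] \dfrac{t-z}{1-z}, & \text{if } t>z.\end{cases}$$ Then $f_\alpha\in\mathcal{R}(n,\alpha)$ for all positive integers $n$.
   Context: $S^{n-1}$ denotes the set of unit vectors in $\mathbb{R}^n$. For $0\le\alpha\le\pi$, $\mathcal{R}(n,\alpha)$ denotes the set of functions $f:[-1,1]\to\mathbb{R}$ such that $$\sum_{i=0}^{N} f(\langle \mathbf{x}_0,\mathbf{x}_i\rangle)\ge 0$$ for every finite family $\mathbf{x}_0,\mathbf{x}_1,\ldots,\mathbf{x}_N\in S^{n-1}$ with $\langle\mathbf{x}_i,\mathbf{x}_j\rangle\le\cos\alpha$ for all $0\le i<j\le N$. (The term $i=0$ of the sum is $f(\langle\mathbf{x}_0,\mathbf{x}_0\rangle)=f(1)$.) *)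

theory Defs
  imports "HOL-Analysis.Analysis"
begin

(* The dimension n is CARD('n), passed through TYPE('n); the class finite makes it a positive
   integer, and every positive integer occurs. Functions on [-1,1] are represented by total
   functions on the reals: inner products of unit vectors lie in [-1,1], so values outside that
   interval play no role. *)
definition \<R> :: "'n::finite itself \<Rightarrow> real \<Rightarrow> (real \<Rightarrow> real) set" where
  "\<R> _ \<alpha> = {f. \<forall>(N::nat) (x :: nat \<Rightarrow> real ^ 'n).
      (\<forall>i\<le>N. x i \<in> sphere 0 1) \<and>
      (\<forall>i j. i < j \<and> j \<le> N \<longrightarrow> x i \<bullet> x j \<le> cos \<alpha>)
      \<longrightarrow> 0 \<le> (\<Sum>i=0..N. f (x 0 \<bullet> x i))}"

definition f_alpha :: "real \<Rightarrow> real \<Rightarrow> real" where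
  "f_alpha \<alpha> t = (let z = cos \<alpha> in
     if t < - sqrt z then (z - t\<^sup>2) / (1 - z)
     else if t \<le> z then 0
     else (t - z) / (1 - z))"

end

(* Only the vectors x i with x 0 \<bullet> x i < - sqrt z contribute negative terms. Testing x 0 against their
   combination weighted by the inner products t i = x 0 \<bullet> x i, the Cauchy-Schwarz inequality gives
   Q^2 \<le> (1 - z) Q + z (sum of t i)^2 \<le> (1 - z) Q + z n Q for Q = sum of (t i)^2, where n is the
   number of such vectors. Hence Q - n z \<le> 1 - z, which is what the term f(1) = 1 has to compensate. *)
theory Submission
  imports Defs
begin

text \<open>For nonempty \<open>I\<close> the bound is the largest eigenvalue of the matrix with
  diagonal 1 and all other entries \<open>z\<close>. This matrix dominates the Gram matrix of the
  \<open>x i\<close> entrywise, and \<open>neg\<close> lets the quadratic forms be compared at the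
  vector of the \<open>e \<bullet> x i\<close>.\<close>

lemma sum_square_inner_le:
  fixes e :: "'v::real_inner" and x :: "'i \<Rightarrow> 'v" and z :: real
  assumes fin: "finite I" and e: "norm e = 1" and z: "0 \<le> z" "z \<le> 1"
    and unit: "\<And>i. i \<in> I \<Longrightarrow> norm (x i) = 1"
    and sep: "\<And>i j. i \<in> I \<Longrightarrow> j \<in> I \<Longrightarrow> i \<noteq> j \<Longrightarrow> x i \<bullet> x j \<le> z"
    and neg: "\<And>i. i \<in> I \<Longrightarrow> e \<bullet> x i \<le> 0"
  shows "(\<Sum>i\<in>I. (e \<bullet> x i)\<^sup>2) \<le> 1 - z + card I * z"
proof -
  define t where "t i = e \<bullet> x i" for i
  define Q where "Q = (\<Sum>i\<in>I. (t i)\<^sup>2)"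
  define v where "v = (\<Sum>i\<in>I. t i *\<^sub>R x i)"
  have ev: "e \<bullet> v = Q"
    by (simp add: v_def Q_def t_def inner_sum_right power2_eq_square)
  have Q0: "0 \<le> Q"
    by (simp add: Q_def sum_nonneg)
  \<comment> \<open>The \<open>t i\<close> share a sign, so the separation bound may be multiplied
    by \<open>t i * t j\<close>. On the diagonal the inner product is 1 instead of \<open>z\<close>,
    whence the extra summand.\<close>
  have term_le: "t i * t j * (x i \<bullet> x j) \<le> t i * t j * z + (if i = j then (1 - z) * (t i)\<^sup>2 else 0)"
    if "i \<in> I" "j \<in> I" for i j
  proof (cases "i = j")
    case True
    then show ?thesis
      using unit[OF that(1)] by (simp add: dot_square_norm power2_eq_square algebra_simps)
  next
    case False
    have "0 \<le> t i * t j"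
      using neg that by (simp add: t_def mult_nonpos_nonpos)
    then show ?thesis
      using False sep[OF that] by (simp add: mult_left_mono)
  qed
  have "v \<bullet> v = (\<Sum>i\<in>I. \<Sum>j\<in>I. t i * t j * (x i \<bullet> x j))"
    by (simp add: v_def inner_sum_left inner_sum_right sum_distrib_left mult.assoc mult.left_commute inner_commute)
  also have "\<dots> \<le> (\<Sum>i\<in>I. \<Sum>j\<in>I. t i * t j * z + (if i = j then (1 - z) * (t i)\<^sup>2 else 0))"
    by (intro sum_mono term_le)
  also have "\<dots> = z * (\<Sum>i\<in>I. t i)\<^sup>2 + (1 - z) * Q"
    using fin
    by (simp add: sum.distrib Q_def power2_eq_square sum_product sum_distrib_left mult_ac)
  \<comment> \<open>Cauchy-Schwarz against the constant vector 1; replacing the square under the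
    factor \<open>z\<close> needs \<open>0 \<le> z\<close>.\<close>
  also have "(\<Sum>i\<in>I. t i)\<^sup>2 \<le> card I * Q"
    using sum_squared_le_sum_of_squares[of t I] by (simp add: Q_def mult.commute)
  finally have vv: "v \<bullet> v \<le> z * (card I * Q) + (1 - z) * Q"
    using z by (simp add: mult_left_mono)
  have "Q\<^sup>2 \<le> v \<bullet> v"
    using Cauchy_Schwarz_ineq[of e v] e by (simp add: ev dot_square_norm)
  with vv have "Q * Q \<le> (1 - z + card I * z) * Q"
    by (simp add: power2_eq_square algebra_simps)
  \<comment> \<open>This settles the case \<open>Q = 0\<close>, where \<open>Q\<close> cannot be
    cancelled.\<close>
  moreover have "0 \<le> 1 - z + card I * z"
    using z by simp
  ultimately have "Q \<le> 1 - z + card I * z"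
    using Q0 by (cases "Q = 0") (auto simp: mult_le_cancel_right)
  then show ?thesis
    by (simp add: Q_def t_def)
qed

theorem theorem4p3:
  fixes \<alpha> z :: real
  assumes "0 \<le> \<alpha>" and "\<alpha> \<le> pi"
    and "z = cos \<alpha>" and "0 \<le> z" and "z < 1"
  shows "f_alpha \<alpha> \<in> \<R> TYPE('n::finite) \<alpha>"
  unfolding \<R>_def
proof (intro CollectI allI impI, elim conjE)
  fix N :: nat and x :: "nat \<Rightarrow> real ^ 'n"
  assume sph: "\<forall>i\<le>N. x i \<in> sphere 0 1"
    and sep: "\<forall>i j. i < j \<and> j \<le> N \<longrightarrow> x i \<bullet> x j \<le> cos \<alpha>"
  note z = \<open>z = cos \<alpha>\<close> \<open>0 \<le> z\<close> \<open>z < 1\<close>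
  define t where "t i = x 0 \<bullet> x i" for i
  \<comment> \<open>These are the indices of the negative terms. Index 0 is kept apart, since its
    term has to pay for them.\<close>
  define I where "I = {i \<in> {1..N}. t i < - sqrt z}"
  have unit: "norm (x i) = 1" if "i \<le> N" for i
    using sph that by simp
  have sep': "x i \<bullet> x j \<le> z" if "i \<le> N" "j \<le> N" "i \<noteq> j" for i j
    using sep that z(1) by (metis inner_commute linorder_neqE_nat)
  have "(\<Sum>i\<in>I. (t i)\<^sup>2) \<le> 1 - z + card I * z"
    unfolding t_def
  proof (rule sum_square_inner_le)
    show "x 0 \<bullet> x i \<le> 0" if "i \<in> I" for i
    proof -
      have "x 0 \<bullet> x i < - sqrt z"
        using that by (simp add: I_def t_def)
      then show ?thesis
        using real_sqrt_ge_zero[OF z(2)] by linarith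
    qed
  qed (use z(2,3) in \<open>auto simp: I_def unit sep'\<close>)
  \<comment> \<open>Summing \<open>z\<close> over \<open>I\<close> gives \<open>card I * z\<close>,
    so the dependence on the number of vectors cancels.\<close>
  then have "- 1 * (1 - z) \<le> (\<Sum>i\<in>I. z - (t i)\<^sup>2)"
    by (simp add: sum_subtractf)
  then have "- 1 \<le> (\<Sum>i\<in>I. z - (t i)\<^sup>2) / (1 - z)"
    using z(3) by (subst pos_le_divide_eq) auto
  also have "\<dots> = (\<Sum>i\<in>I. f_alpha \<alpha> (t i))"
    using z(1) by (simp add: sum_divide_distrib I_def f_alpha_def Let_def)
  also have "\<dots> = (\<Sum>i=1..N. f_alpha \<alpha> (t i))"
  proof (rule sum.mono_neutral_left)
    \<comment> \<open>Separation from \<open>x 0\<close> forces \<open>t i \<le> z\<close> for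
      \<open>i \<ge> 1\<close>, so only the middle branch remains; the positive branch is reached at
      index 0 alone.\<close>
    show "\<forall>i\<in>{1..N} - I. f_alpha \<alpha> (t i) = 0"
      using sep' z(1) by (auto simp: I_def f_alpha_def Let_def t_def)
  qed (auto simp: I_def)
  finally have "- 1 \<le> (\<Sum>i=1..N. f_alpha \<alpha> (t i))" .
  moreover have "f_alpha \<alpha> (t 0) = 1"
  proof -
    have "t 0 = 1"
      using unit[of 0] by (simp add: t_def dot_square_norm)
    moreover have "\<not> 1 < - sqrt z"
      using z(2) real_sqrt_ge_zero[of z] by linarith
    ultimately show ?thesis
      using z by (simp add: f_alpha_def Let_def)
  qed
  ultimately have "0 \<le> (\<Sum>i=0..N. f_alpha \<alpha> (t i))"
    by (simp add: sum.atLeast_Suc_atMost)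
  then show "0 \<le> (\<Sum>i=0..N. f_alpha \<alpha> (x 0 \<bullet> x i))"
    by (simp add: t_def)
qed

end
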